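(* Let $\Omega$ be a fluid domain in $\nu$ dimensions carrying a continuum density $\rho$, velocity $\mathbf{u}$ and pressure $p$, and for each point $\mathbf{r}$ let $\Omega_h(\mathbf{r})$ be its test space, a locally compact space within $\Omega$ centred at $\mathbf{r}$. Let $w_h\in C_c^\infty(\Omega_h)$ be a convolution filter, let $\langle\rho_h\rangle,\widetilde{\mathbf{u}}_h,\langle p_h\rangle$ be the filtered fields obtained from $\rho,\mathbf{u},p$ by the filtering integral transform (FIT) with $w_h$, and let $\varphi_h\in C_c^\infty(\Omega_h)$ be a deconvolution filter associated with $w_h$, i.e. one for which the de-filtering integral transform (DIT) holds (both transforms are written out in the context). Suppose the filtered fields satisfy the filtered continuity equation $$\frac{d}{dt}\langle\rho_h(\mathbf{r})\rangle=-\langle\rho_h(\mathbf{r})\rangle\,\nabla\cdot\widetilde{\mathbf{u}}_h(\mathbf{r}),\qquad \frac{d}{dt}=\frac{\partial}{\partial t}+\widetilde{\mathbf{u}}_h\cdot\nabla .$$ Let the target particle at $\mathbf{r}$ move with the de-filtered velocity, $\frac{d\mathbf{r}}{dt}=\mathbf{u}(\mathbf{r})$, and the support particles at $\mathbf{r}'\in\Omega_h(\mathbf{r})$ with the filtered velocity, $\frac{d\mathbf{r}'}{dt}=\widetilde{\mathbf{u}}_h(\mathbf{r}')$. Then testing the filtered continuity equation (at the points $\mathbf{r}'\in\Omega_h(\mathbf{r})$) with $\varphi_h(\mathbf{r}-\mathbf{r}')$ over $\Omega_h(\mathbf{r})$ yields the de-filtered continuity equation $$\frac{d}{dt}\rho(\mathbf{r})=\int_{\Omega_h(\mathbf{r})}\langle\rho_h(\mathbf{r}')\rangle\,\big(\mathbf{u}(\mathbf{r})-\widetilde{\mathbf{u}}_h(\mathbf{r}')\big)\cdot\nabla\varphi_h(\mathbf{r}-\mathbf{r}')\,d^\nu\mathbf{r}'.$$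 Moreover, the right-hand side equals $-\rho(\mathbf{r})\nabla\cdot\mathbf{u}(\mathbf{r})$, so that this equation is equivalent to the point form of the continuum continuity equation $$\frac{d}{dt}\rho(\mathbf{r})=-\rho(\mathbf{r})\,\nabla\cdot\mathbf{u}(\mathbf{r}).$$
   Context: FIT: $$\langle\rho_h(\mathbf{r})\rangle=\int_{\Omega_h(\mathbf{r})}\rho(\mathbf{r}')w_h(\mathbf{r}-\mathbf{r}')\,d^\nu\mathbf{r}',\quad \langle\rho_h(\mathbf{r})\rangle\widetilde{\mathbf{u}}_h(\mathbf{r})=\int_{\Omega_h(\mathbf{r})}\rho(\mathbf{r}')\mathbf{u}(\mathbf{r}')w_h(\mathbf{r}-\mathbf{r}')\,d^\nu\mathbf{r}',\quad \langle p_h(\mathbf{r})\rangle=\int_{\Omega_h(\mathbf{r})}p(\mathbf{r}')w_h(\mathbf{r}-\mathbf{r}')\,d^\nu\mathbf{r}'.$$ DIT: for each $w_h\in C_c^\infty(\Omega_h)$ it is posited that there exists $\varphi_h\in C_c^\infty(\Omega_h)$ such that $$\rho(\mathbf{r})=\int_{\Omega_h(\mathbf{r})}\langle\rho_h(\mathbf{r}')\rangle\varphi_h(\mathbf{r}-\mathbf{r}')\,d^\nu\mathbf{r}',\quad \rho(\mathbf{r})\mathbf{u}(\mathbf{r})=\int_{\Omega_h(\mathbf{r})}\langle\rho_h(\mathbf{r}')\rangle\widetilde{\mathbf{u}}_h(\mathbf{r}')\varphi_h(\mathbf{r}-\mathbf{r}')\,d^\nu\mathbf{r}',\quad p(\mathbf{r})=\int_{\Omega_h(\mathbf{r})}\langle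 p_h(\mathbf{r}')\rangle\varphi_h(\mathbf{r}-\mathbf{r}')\,d^\nu\mathbf{r}'.$$ $\nabla$ is the gradient with respect to $\mathbf{r}$; the gradient $\nabla'$ with respect to $\mathbf{r}'$ satisfies $\nabla'\varphi_h(\mathbf{r}-\mathbf{r}')=-\nabla\varphi_h(\mathbf{r}-\mathbf{r}')$. In $\frac{d}{dt}\rho(\mathbf{r})$ the derivative is taken following the target particle, $\frac{d\mathbf{r}}{dt}=\mathbf{u}(\mathbf{r})$. Time dependence of the fields is suppressed. *)

theory Defs
  imports "HOL-Analysis.Analysis"
begin

definition grad :: "('a::euclidean_space \<Rightarrow> real) \<Rightarrow> 'a \<Rightarrow> 'a" where
  "grad f x = (\<Sum>b\<in>Basis. frechet_derivative f (at x) b *\<^sub>R b)"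

definition divergence :: "('a::euclidean_space \<Rightarrow> 'a) \<Rightarrow> 'a \<Rightarrow> real" where
  "divergence v x = (\<Sum>b\<in>Basis. frechet_derivative v (at x) b \<bullet> b)"

text \<open>Fields depend on time first and on position second. This is
  \<open>\<partial>f/\<partial>t + v \<bullet> \<nabla>f\<close>.\<close>

definition material_deriv ::
  "(real \<Rightarrow> 'a::euclidean_space \<Rightarrow> 'a) \<Rightarrow> (real \<Rightarrow> 'a \<Rightarrow> real) \<Rightarrow> real \<Rightarrow> 'a \<Rightarrow> real" where
  "material_deriv v f t x = deriv (\<lambda>s. f s x) t + v t x \<bullet> grad (f t) x"

text \<open>Continuous differentiability, intended for open \<open>S\<close>.\<close>

definition C1_on :: "'a::real_normed_vector set \<Rightarrow> ('a \<Rightarrow> 'b::real_normed_vector) \<Rightarrow> bool" where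
  "C1_on S f \<longleftrightarrow>
     (\<exists>f'. (\<forall>x\<in>S. (f has_derivative blinfun_apply (f' x)) (at x)) \<and> continuous_on S f')"

text \<open>\<open>C\<^sup>k\<close> on the whole space: all iterated partial derivatives up to order \<open>k\<close> exist (with
  Frechet differentiability at every order below \<open>k\<close>) and are continuous.\<close>

primrec Ck :: "nat \<Rightarrow> ('a::euclidean_space \<Rightarrow> real) \<Rightarrow> bool" where
  "Ck 0 f \<longleftrightarrow> continuous_on UNIV f"
| "Ck (Suc k) f \<longleftrightarrow>
     (\<forall>x. f differentiable (at x)) \<and> (\<forall>b\<in>Basis. Ck k (\<lambda>x. frechet_derivative f (at x) b))"

text \<open>\<open>C\<^sub>c\<^sup>\<infinity>(S)\<close>; its elements are regarded as extended by zero outside \<open>S\<close>.\<close>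

definition Cc_infinity :: "'a::euclidean_space set \<Rightarrow> ('a \<Rightarrow> real) set" where
  "Cc_infinity S =
     {f. (\<forall>k. Ck k f) \<and> compact (closure {x. f x \<noteq> 0}) \<and> closure {x. f x \<noteq> 0} \<subseteq> S}"

text \<open>Only membership of the centre is required: neither a radius nor a shape is prescribed.\<close>

definition test_space :: "'a::euclidean_space set \<Rightarrow> 'a \<Rightarrow> 'a set \<Rightarrow> bool" where
  "test_space \<Omega> r S \<longleftrightarrow> locally compact S \<and> S \<subseteq> \<Omega> \<and> r \<in> S"

text \<open>The kernel \<open>k\<close> is a function of the difference \<open>r - r'\<close>. It belongs to the test functions
  on the test space of \<open>r\<close> when \<open>r' \<mapsto> k (r - r')\<close> does; \<open>D\<close> is the set of points \<open>r\<close> that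
  carry a test space.\<close>

definition filter_kernel ::
  "'a::euclidean_space set \<Rightarrow> ('a \<Rightarrow> 'a set) \<Rightarrow> ('a \<Rightarrow> real) \<Rightarrow> bool" where
  "filter_kernel D \<Omega>h k \<longleftrightarrow> (\<forall>r\<in>D. (\<lambda>r'. k (r - r')) \<in> Cc_infinity (\<Omega>h r))"

text \<open>The density-weighted integral transform with kernel \<open>k\<close>, at the point \<open>r\<close>, taking density,
  velocity and pressure \<open>(\<rho>, u, p)\<close> to \<open>(\<rho>', u', p')\<close>. The velocity \<open>u'\<close> is determined only
  through the momentum \<open>\<rho>' u'\<close>. The filtering and the de-filtering transform are both of this
  form: the former from the continuum to the filtered fields with the convolution filter, the
  latter from the filtered back to the continuum fields with the deconvolution filter.\<close>

definition integral_transform ::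
  "('a::euclidean_space \<Rightarrow> 'a set) \<Rightarrow> ('a \<Rightarrow> real) \<Rightarrow>
   ('a \<Rightarrow> real) \<Rightarrow> ('a \<Rightarrow> 'a) \<Rightarrow> ('a \<Rightarrow> real) \<Rightarrow>
   ('a \<Rightarrow> real) \<Rightarrow> ('a \<Rightarrow> 'a) \<Rightarrow> ('a \<Rightarrow> real) \<Rightarrow> 'a \<Rightarrow> bool" where
  "integral_transform \<Omega>h k \<rho> u p \<rho>' u' p' r \<longleftrightarrow>
     \<rho>' r = (LINT x:\<Omega>h r|lborel. \<rho> x * k (r - x)) \<and>
     \<rho>' r *\<^sub>R u' r = (LINT x:\<Omega>h r|lborel. (\<rho> x * k (r - x)) *\<^sub>R u x) \<and>
     p' r = (LINT x:\<Omega>h r|lborel. p x * k (r - x))"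

end

theory Submission
  imports Defs
begin

text \<open>Write \<open>G\<close> for the de-filtered momentum \<open>r \<mapsto> \<integral> \<phi> (r - x) \<rho>h(x) uh(x) dx\<close>. Its derivative can be
  computed with the derivative falling on \<open>\<phi>\<close>, or, after the substitution \<open>y = r - x\<close>, on the
  filtered fields; comparing the two replaces integration by parts. In the second form the filtered
  continuity equation identifies \<open>-div G\<close> with the time derivative of \<open>\<rho>\<close>, while the first form and
  the chain rule along the target particle give the integral on the right-hand side. The point form
  follows since \<open>G = \<rho> u\<close>.\<close>

section \<open>Lebesgue integrals: reflection, compact support, extension by zero\<close>

lemma lborel_integral_reflect:
  fixes f :: "'a::euclidean_space \<Rightarrow> 'b::{banach, second_countable_topology}"
  shows "(LINT x|lborel. f (c - x)) = (LINT x|lborel. f x)"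
proof -
  \<comment> \<open>The reflection is affine with factor -1, so its Jacobian has absolute value
    1.\<close>
  have d: "distr lborel borel (\<lambda>x. c - x) = lborel"
    by (subst (2) lborel_affine[of "-1" c]) (simp_all add: density_1)
  show ?thesis
  proof (cases "f \<in> borel_measurable borel")
    case True
    then show ?thesis
      using integral_distr[of "\<lambda>x. c - x" lborel borel f] by (simp add: d)
  next
    case False
    \<comment> \<open>A non-measurable \<open>f\<close> has a non-measurable reflection, so both
      integrals take the default value 0.\<close>
    have "(\<lambda>x. f (c - x)) \<notin> borel_measurable borel"
    proof
      assume "(\<lambda>x. f (c - x)) \<in> borel_measurable borel"
      then have "(\<lambda>x. f (c - (c - x))) \<in> borel_measurable borel"
        by (rule measurable_compose[rotated]) simp
      with False show False by simp
    qed
    with False have "\<not> integrable lborel f" "\<not> integrable lborel (\<lambda>x. f (c - x))"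
      by (auto dest: borel_measurable_integrable)
    then show ?thesis by (simp add: not_integrable_integral_eq)
  qed
qed

lemma integrable_continuous_compact_support:
  fixes f :: "'a::euclidean_space \<Rightarrow> 'b::{banach, second_countable_topology}"
  assumes "compact C" and "continuous_on UNIV f" and "\<And>x. x \<notin> C \<Longrightarrow> f x = 0"
  shows "integrable lborel f"
proof -
  have "(\<lambda>x. indicator C x *\<^sub>R f x) = f"
    using assms(3) by (fastforce simp: indicator_def)
  with borel_integrable_compact[OF assms(1) continuous_on_subset[OF assms(2) subset_UNIV]]
  show ?thesis by simp
qed

text \<open>Bridge from the Lebesgue integral, in which the transforms are written, to the gauge
  integral over a box, for which \<open>leibniz_rule\<close> is stated.\<close>

lemma lborel_integral_eq_integral_cbox:
  fixes f :: "'a::euclidean_space \<Rightarrow> 'b::euclidean_space"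
  assumes "continuous_on UNIV f" and "\<And>x. x \<notin> cbox a b \<Longrightarrow> f x = 0"
  shows "(LINT x|lborel. f x) = integral (cbox a b) f"
proof -
  have "(\<lambda>x. indicator (cbox a b) x *\<^sub>R f x) = f"
    using assms(2) by (fastforce simp: indicator_def)
  moreover have "set_integrable lborel (cbox a b) f"
    unfolding set_integrable_def
    using borel_integrable_compact[OF compact_cbox continuous_on_subset[OF assms(1) subset_UNIV]] .
  ultimately show ?thesis
    using set_borel_integral_eq_integral(2)[of "cbox a b" f]
    by (simp add: set_lebesgue_integral_def)
qed

lemma set_lebesgue_integral_eq_integral_support:
  assumes "\<And>x. x \<notin> S \<Longrightarrow> f x = 0"
  shows "(LINT x:S|M. f x) = (LINT x|M. f x)"
  unfolding set_lebesgue_integral_def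
  using assms by (intro Bochner_Integration.integral_cong) (auto simp: indicator_def)

text \<open>Continuity is local, so it can be checked on two open pieces. In the applications
  \<open>A\<close> is where the fields are regular and \<open>B\<close> is where the kernel
  vanishes; this makes integrands continuous on the whole space although the fields are controlled
  on \<Omega> alone.\<close>

lemma continuous_on_extend_by_zero:
  assumes "open A" and "open B" and "S \<subseteq> A \<union> B"
    and "continuous_on A f" and "\<And>x. x \<in> B \<Longrightarrow> f x = 0"
  shows "continuous_on S f"
proof -
  have "continuous_on B f"
    using assms(5) by (simp cong: continuous_on_cong)
  with assms show ?thesis
    by (meson continuous_on_open_Un continuous_on_subset)
qed

section \<open>Differentiation under the integral sign\<close>

lemma has_derivative_integral_compact_support:
  fixes H :: "'c::banach \<Rightarrow> 'a::euclidean_space \<Rightarrow> 'b::euclidean_space"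
  assumes "open U" and "convex U" and "z0 \<in> U" and "compact C"
    and supp: "\<And>z y. z \<in> U \<Longrightarrow> y \<notin> C \<Longrightarrow> H z y = 0"
    and cont: "\<And>z. z \<in> U \<Longrightarrow> continuous_on UNIV (H z)"
    and der: "\<And>z y. z \<in> U \<Longrightarrow> ((\<lambda>z. H z y) has_derivative blinfun_apply (H' z y)) (at z)"
    and cont': "continuous_on (U \<times> UNIV) (\<lambda>(z, y). H' z y)"
  shows "((\<lambda>z. LINT y|lborel. H z y) has_derivative (\<lambda>v. LINT y|lborel. H' z0 y v)) (at z0)"
proof -
  \<comment> \<open>One box serves all parameters, because \<open>C\<close> does not depend on
    \<open>z\<close>; the domain of integration is thereby fixed and bounded.\<close>
  obtain a b where ab: "C \<subseteq> cbox a b"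
    using \<open>compact C\<close> bounded_subset_cbox_symmetric compact_imp_bounded by metis
  \<comment> \<open>Off \<open>C\<close> the map \<open>\<lambda>z. H z y\<close> vanishes on all of
    the open set \<open>U\<close>, hence so does its derivative.\<close>
  have supp': "H' z0 y v = 0" if "y \<notin> C" for y v
  proof -
    have "((\<lambda>z. H z y) has_derivative (\<lambda>_. 0)) (at z0)"
      by (rule has_derivative_transform_within_open[of "\<lambda>_. 0" _ _ _ U])
        (use \<open>open U\<close> \<open>z0 \<in> U\<close> supp that in auto)
    then show ?thesis
      using has_derivative_unique[OF der[OF \<open>z0 \<in> U\<close>]] by metis
  qed
  have contH': "continuous_on UNIV (H' z0)"
  proof -
    have "continuous_on UNIV (\<lambda>y. (z0, y))" by (intro continuous_intros)
    from continuous_on_compose2[OF cont' this] \<open>z0 \<in> U\<close> show ?thesis by auto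
  qed
  have integral_eq: "integral (cbox a b) (H z) = (LINT y|lborel. H z y)" if "z \<in> U" for z
    by (rule lborel_integral_eq_integral_cbox[OF cont[OF that], symmetric]) (use ab supp that in blast)
  have "((\<lambda>z. integral (cbox a b) (H z)) has_derivative integral (cbox a b) (H' z0))
      (at z0 within U)"
  proof (rule leibniz_rule)
    show "continuous_on (U \<times> cbox a b) (\<lambda>(z, y). H' z y)"
      by (rule continuous_on_subset[OF cont']) auto
    show "H z integrable_on cbox a b" if "z \<in> U" for z
      by (rule integrable_continuous[OF continuous_on_subset[OF cont[OF that] subset_UNIV]])
  qed (rule has_derivative_at_withinI[OF der] \<open>z0 \<in> U\<close> \<open>convex U\<close>; assumption)+
  then have "((\<lambda>z. integral (cbox a b) (H z)) has_derivative integral (cbox a b) (H' z0)) (at z0)"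
    by (simp only: at_within_open[OF \<open>z0 \<in> U\<close> \<open>open U\<close>])
  then have "((\<lambda>z. LINT y|lborel. H z y) has_derivative integral (cbox a b) (H' z0)) (at z0)"
    by (rule has_derivative_transform_within_open[OF _ \<open>open U\<close> \<open>z0 \<in> U\<close>]) (rule integral_eq)
  \<comment> \<open>\<open>leibniz_rule\<close> yields the integral of a
    \<open>blinfun\<close>-valued function; evaluation at \<open>v\<close> is bounded linear and
    commutes with it.\<close>
  moreover have "blinfun_apply (integral (cbox a b) (H' z0)) = (\<lambda>v. LINT y|lborel. H' z0 y v)"
  proof
    fix v
    have "blinfun_apply (integral (cbox a b) (H' z0)) v = integral (cbox a b) (\<lambda>y. H' z0 y v)"
      by (intro blinfun_apply_integral integrable_continuous continuous_on_subset[OF contH']) simp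
    also have "\<dots> = (LINT y|lborel. H' z0 y v)"
      using ab supp' by (intro lborel_integral_eq_integral_cbox[symmetric] continuous_intros contH') auto
    finally show "blinfun_apply (integral (cbox a b) (H' z0)) v = (LINT y|lborel. H' z0 y v)" .
  qed
  ultimately show ?thesis by simp
qed

section \<open>Convolution of a compactly supported kernel with a field\<close>

lemma continuous_on_convolution_integrand:
  fixes F :: "'a::real_normed_vector \<Rightarrow> 'b::real_normed_vector"
  assumes "open \<Omega>" and "closed K" and \<phi>: "continuous_on UNIV \<phi>" "\<And>y. y \<notin> K \<Longrightarrow> \<phi> y = 0"
    and sub: "\<And>y. y \<in> K \<Longrightarrow> r - y \<in> \<Omega>" and F: "continuous_on \<Omega> F"
  shows "continuous_on UNIV (\<lambda>x. \<phi> (r - x) *\<^sub>R F x)"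
proof (rule continuous_on_extend_by_zero[OF \<open>open \<Omega>\<close>])
  show "open ((\<lambda>x. r - x) -` (- K))"
    using \<open>closed K\<close> by (intro open_vimage continuous_intros) simp_all
  show "UNIV \<subseteq> \<Omega> \<union> (\<lambda>x. r - x) -` (- K)" using sub[of "r - x" for x] by auto
  show "continuous_on \<Omega> (\<lambda>x. \<phi> (r - x) *\<^sub>R F x)"
    by (intro continuous_intros F continuous_on_compose2[OF \<phi>(1)]) auto
qed (use \<phi>(2) in auto)

lemma integrable_convolution_integrand:
  fixes F :: "'a::euclidean_space \<Rightarrow> 'b::{banach, second_countable_topology}"
  assumes "open \<Omega>" and "compact K" and \<phi>: "continuous_on UNIV \<phi>" "\<And>y. y \<notin> K \<Longrightarrow> \<phi> y = 0"
    and sub: "\<And>y. y \<in> K \<Longrightarrow> r - y \<in> \<Omega>" and F: "continuous_on \<Omega> F"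
  shows "integrable lborel (\<lambda>x. \<phi> (r - x) *\<^sub>R F x)"
proof (rule integrable_continuous_compact_support)
  show "compact ((\<lambda>y. r - y) ` K)"
    using \<open>compact K\<close> by (intro compact_continuous_image continuous_intros)
  show "continuous_on UNIV (\<lambda>x. \<phi> (r - x) *\<^sub>R F x)"
    using assms by (intro continuous_on_convolution_integrand[of \<Omega> K]) (auto simp: compact_imp_closed)
  show "\<phi> (r - x) *\<^sub>R F x = 0" if "x \<notin> (\<lambda>y. r - y) ` K" for x
    using that \<phi>(2)[of "r - x"] image_eqI[of x "\<lambda>y. r - y" "r - x" K] by auto
qed

text \<open>With y = r - x as integration variable, the point \<open>r\<close> enters through
  \<open>F\<close> alone and the support \<open>K\<close> in y stays fixed, so the derivative falls
  on \<open>F\<close> and continuity of \<phi> suffices. Time and position are differentiated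
  jointly, in preparation for the chain rule along the target particle.\<close>

lemma has_derivative_convolution_field:
  fixes F :: "real \<times> 'a::euclidean_space \<Rightarrow> 'b::euclidean_space"
  assumes "open T" and "open \<Omega>" and "open D" and "compact K"
    and \<phi>: "continuous_on UNIV \<phi>" "\<And>y. y \<notin> K \<Longrightarrow> \<phi> y = 0"
    and sub: "\<And>r y. r \<in> D \<Longrightarrow> y \<in> K \<Longrightarrow> r - y \<in> \<Omega>"
    and F: "\<And>z. z \<in> T \<times> \<Omega> \<Longrightarrow> (F has_derivative blinfun_apply (F' z)) (at z)"
    and F': "continuous_on (T \<times> \<Omega>) F'"
    and "t \<in> T" and "r \<in> D"
  shows "((\<lambda>z. LINT x|lborel. \<phi> (snd z - x) *\<^sub>R F (fst z, x)) has_derivative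
      (\<lambda>v. LINT x|lborel. \<phi> (r - x) *\<^sub>R F' (t, x) v)) (at (t, r))"
proof -
  \<comment> \<open>The parameters are restricted to a ball, since the Leibniz rule asks for a
    convex set and \<open>T \<times> D\<close> may fail to be one.\<close>
  have "open (T \<times> D)" using \<open>open T\<close> \<open>open D\<close> by (rule open_Times)
  then obtain e where e: "e > 0" "ball (t, r) e \<subseteq> T \<times> D"
    using \<open>t \<in> T\<close> \<open>r \<in> D\<close> openE by blast
  have contF: "continuous_on (T \<times> \<Omega>) F"
    by (rule has_derivative_continuous_on[OF has_derivative_at_withinI[OF F]])
  define H where "H z y = \<phi> y *\<^sub>R F (fst z, snd z - y)" for z y
  define H' where "H' z y = \<phi> y *\<^sub>R F' (fst z, snd z - y)" for z y
  have "((\<lambda>z. LINT y|lborel. H z y) has_derivative (\<lambda>v. LINT y|lborel. H' (t, r) y v)) (at (t, r))"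
  proof (rule has_derivative_integral_compact_support[of "ball (t, r) e" _ K])
    show "H z y = 0" if "y \<notin> K" for z y
      using that \<phi>(2) by (simp add: H_def)
    show "continuous_on UNIV (H z)" if "z \<in> ball (t, r) e" for z
    proof (rule continuous_on_extend_by_zero)
      show "open ((\<lambda>y. snd z - y) -` \<Omega>)"
        using \<open>open \<Omega>\<close> by (intro open_vimage continuous_intros)
      show "continuous_on ((\<lambda>y. snd z - y) -` \<Omega>) (H z)"
        unfolding H_def using that e
        by (intro continuous_intros continuous_on_compose2[OF contF] continuous_on_subset[OF \<phi>(1)]) auto
      show "open (- K)" using \<open>compact K\<close> by (simp add: compact_imp_closed open_Compl)
      show "UNIV \<subseteq> (\<lambda>y. snd z - y) -` \<Omega> \<union> - K" using that e sub by (cases z) auto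
    qed (use \<phi>(2) in \<open>auto simp: H_def\<close>)
    show "((\<lambda>z. H z y) has_derivative blinfun_apply (H' z y)) (at z)"
      if "z \<in> ball (t, r) e" for z y
    proof (cases "y \<in> K")
      case True
      have "((\<lambda>z. (fst z, snd z - y)) has_derivative (\<lambda>v. v)) (at z)"
        by (auto intro!: derivative_eq_intros)
      moreover have "(fst z, snd z - y) \<in> T \<times> \<Omega>" using that e sub True by (cases z) auto
      ultimately have "((\<lambda>z. F (fst z, snd z - y)) has_derivative
          (\<lambda>v. F' (fst z, snd z - y) v)) (at z)"
        using has_derivative_compose F by blast
      from has_derivative_scaleR_right[OF this, of "\<phi> y"] show ?thesis
        by (simp add: H_def[abs_def] H'_def scaleR_blinfun.rep_eq)
    qed (use \<phi>(2) in \<open>auto simp: H_def H'_def zero_blinfun.rep_eq\<close>)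
    show "continuous_on (ball (t, r) e \<times> UNIV) (\<lambda>(z, y). H' z y)"
    proof (rule continuous_on_extend_by_zero)
      let ?A = "(\<lambda>p. (fst (fst p), snd (fst p) - snd p)) -` (T \<times> \<Omega>)"
      show "open ?A"
        using \<open>open \<Omega>\<close> \<open>open T\<close> by (intro open_vimage continuous_intros open_Times)
      show "continuous_on ?A (\<lambda>(z, y). H' z y)"
        unfolding H'_def split_beta
        by (intro continuous_intros continuous_on_compose2[OF F'] continuous_on_compose2[OF \<phi>(1)]) auto
      show "open (UNIV \<times> (- K))"
        using \<open>compact K\<close> by (simp add: compact_imp_closed open_Compl open_Times)
      show "ball (t, r) e \<times> UNIV \<subseteq> ?A \<union> UNIV \<times> - K" using e sub by auto
    qed (use \<phi>(2) in \<open>auto simp: H'_def\<close>)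
  qed (use e \<open>compact K\<close> in auto)
  moreover have "(LINT y|lborel. H z y) = (LINT x|lborel. \<phi> (snd z - x) *\<^sub>R F (fst z, x))" for z
    using lborel_integral_reflect[of "H z" "snd z"] by (simp add: H_def)
  moreover have "(LINT y|lborel. H' (t, r) y v) = (LINT x|lborel. \<phi> (r - x) *\<^sub>R F' (t, x) v)" for v
    using lborel_integral_reflect[of "\<lambda>y. H' (t, r) y v" r] by (simp add: H'_def blinfun.scaleR_left)
  ultimately show ?thesis by simp
qed

text \<open>The counterpart of \<open>has_derivative_convolution_field\<close> with the point left
  in the kernel: the derivative falls on \<phi>, and continuity of \<open>F\<close> on \<Omega>
  suffices. Equating the two derivatives of one convolution is integration by parts without boundary
  term.\<close>

lemma has_derivative_convolution_kernel:
  fixes F :: "'a::euclidean_space \<Rightarrow> 'b::euclidean_space"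
  assumes "open \<Omega>" and "open D" and "compact K"
    and \<phi>: "\<And>y. (\<phi> has_derivative blinfun_apply (\<phi>' y)) (at y)" "continuous_on UNIV \<phi>'"
      "\<And>y. y \<notin> K \<Longrightarrow> \<phi> y = 0" "\<And>y. y \<notin> K \<Longrightarrow> \<phi>' y = 0"
    and sub: "\<And>r y. r \<in> D \<Longrightarrow> y \<in> K \<Longrightarrow> r - y \<in> \<Omega>"
    and F: "continuous_on \<Omega> F"
    and "r \<in> D"
  shows "((\<lambda>r. LINT x|lborel. \<phi> (r - x) *\<^sub>R F x) has_derivative
      (\<lambda>v. LINT x|lborel. \<phi>' (r - x) v *\<^sub>R F x)) (at r)"
proof -
  obtain e where e: "e > 0" "cball r e \<subseteq> D"
    using \<open>open D\<close> \<open>r \<in> D\<close> open_contains_cball by blast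
  then have ball_D: "z \<in> D" if "z \<in> ball r e" for z
    using that ball_subset_cball by blast
  \<comment> \<open>In the variable x the support of the integrand moves with \<open>z\<close>. The
    set \<open>C\<close> contains the supports for all \<open>z\<close> near \<open>r\<close>; the
    closed ball is taken so that \<open>C\<close> is compact.\<close>
  define C where "C = {z - y | z y. z \<in> cball r e \<and> y \<in> K}"
  have C: "compact C" unfolding C_def using \<open>compact K\<close> by (intro compact_differences) auto
  have in_C: "x \<in> C" if "z \<in> ball r e" "z - x \<in> K" for z x
  proof -
    have "x = z - (z - x)" "z \<in> cball r e" using that by auto
    with that show ?thesis unfolding C_def by blast
  qed
  have cont\<phi>: "continuous_on UNIV \<phi>"
    by (rule has_derivative_continuous_on[OF has_derivative_at_withinI[OF \<phi>(1)]])
  have K: "open (- K)" using \<open>compact K\<close> by (simp add: compact_imp_closed open_Compl)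
  define H' where "H' z x = blinfun_scaleR_left (F x) o\<^sub>L \<phi>' (z - x)" for z x
  have "((\<lambda>z. LINT x|lborel. \<phi> (z - x) *\<^sub>R F x) has_derivative (\<lambda>v. LINT x|lborel. H' r x v)) (at r)"
  proof (rule has_derivative_integral_compact_support[of "ball r e" _ C])
    show "\<phi> (z - x) *\<^sub>R F x = 0" if "z \<in> ball r e" "x \<notin> C" for z x
      using that in_C \<phi>(3) by auto
    show "continuous_on UNIV (\<lambda>x. \<phi> (z - x) *\<^sub>R F x)" if "z \<in> ball r e" for z
    proof (rule continuous_on_convolution_integrand[OF \<open>open \<Omega>\<close> _ cont\<phi> \<phi>(3) _ F])
      show "closed K" using \<open>compact K\<close> by (rule compact_imp_closed)
      show "z - y \<in> \<Omega>" if "y \<in> K" for y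
        using ball_D[OF \<open>z \<in> ball r e\<close>] that by (rule sub)
    qed
    show "((\<lambda>z. \<phi> (z - x) *\<^sub>R F x) has_derivative blinfun_apply (H' z x)) (at z)" for z x
    proof -
      have "((\<lambda>z. z - x) has_derivative (\<lambda>v. v)) (at z)"
        by (auto intro!: derivative_eq_intros)
      then have "((\<lambda>z. \<phi> (z - x)) has_derivative (\<lambda>v. \<phi>' (z - x) v)) (at z)"
        using has_derivative_compose \<phi>(1) by blast
      then show ?thesis
        by (rule has_derivative_eq_rhs[OF has_derivative_scaleR_left]) (simp add: H'_def fun_eq_iff)
    qed
    show "continuous_on (ball r e \<times> UNIV) (\<lambda>(z, x). H' z x)"
    proof (rule continuous_on_extend_by_zero)
      show "open (UNIV \<times> \<Omega> :: ('a \<times> 'a) set)" using \<open>open \<Omega>\<close> by (simp add: open_Times)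
      show "open ((\<lambda>(z, x). z - x) -` (- K))"
        unfolding split_beta by (intro open_vimage K continuous_intros)
      show "ball r e \<times> UNIV \<subseteq> UNIV \<times> \<Omega> \<union> (\<lambda>(z, x). z - x) -` (- K)"
      proof
        fix p assume "p \<in> ball r e \<times> (UNIV :: 'a set)"
        then obtain z x where "p = (z, x)" "z \<in> D" using ball_D by blast
        then show "p \<in> UNIV \<times> \<Omega> \<union> (\<lambda>(z, x). z - x) -` (- K)"
          using sub[of z "z - x"] by auto
      qed
      show "continuous_on (UNIV \<times> \<Omega>) (\<lambda>(z, x). H' z x)"
        unfolding H'_def split_beta
        by (intro continuous_intros continuous_on_compose2[OF F] continuous_on_compose2[OF \<phi>(2)]) auto
    qed (use \<phi>(4) in \<open>auto simp: H'_def\<close>)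
  qed (use e C in auto)
  then show ?thesis by (simp add: H'_def)
qed

section \<open>Gradient and divergence through the Frechet derivative\<close>

lemma linear_functional_eq_sum_Basis:
  fixes f :: "'a::euclidean_space \<Rightarrow> real"
  assumes "linear f"
  shows "f v = (\<Sum>b\<in>Basis. (v \<bullet> b) * f b)"
proof -
  have "f v = f (\<Sum>b\<in>Basis. (v \<bullet> b) *\<^sub>R b)" by (simp add: euclidean_representation)
  with assms show ?thesis by (simp add: linear_sum linear_cmul)
qed

lemma grad_eq:
  assumes "(f has_derivative f') (at x)"
  shows "v \<bullet> grad f x = f' v"
proof -
  have "v \<bullet> grad f x = (\<Sum>b\<in>Basis. (v \<bullet> b) * f' b)"
    using frechet_derivative_at[OF assms] by (simp add: grad_def inner_sum_right mult.commute)
  with linear_functional_eq_sum_Basis[OF has_derivative_linear[OF assms], of v]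
  show ?thesis by simp
qed

lemma divergence_eq:
  assumes "(v has_derivative v') (at x)"
  shows "divergence v x = (\<Sum>b\<in>Basis. v' b \<bullet> b)"
  using frechet_derivative_at[OF assms] by (simp add: divergence_def)

section \<open>Regularity and support of a filter kernel\<close>

lemma Ck_1_has_blinfun_derivative:
  assumes "Ck (Suc 0) f"
  obtains f' where "\<And>x. (f has_derivative blinfun_apply (f' x)) (at x)" "continuous_on UNIV f'"
proof
  \<comment> \<open>\<open>Ck\<close> provides continuity of the partial derivatives one by one;
    assembling the derivative from them as a finite sum makes it continuous in the operator
    norm.\<close>
  let ?f' = "\<lambda>x. \<Sum>b\<in>Basis. frechet_derivative f (at x) b *\<^sub>R blinfun_inner_left b"
  show "continuous_on UNIV ?f'"
    using assms by (auto intro!: continuous_intros)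
  show "(f has_derivative blinfun_apply (?f' x)) (at x)" for x
  proof -
    have d: "(f has_derivative frechet_derivative f (at x)) (at x)"
      using assms by (simp add: frechet_derivative_works[symmetric])
    have "blinfun_apply (?f' x) = frechet_derivative f (at x)"
    proof
      fix v
      show "blinfun_apply (?f' x) v = frechet_derivative f (at x) v"
        using grad_eq[OF d, of v]
        by (simp add: grad_def blinfun.sum_left blinfun.scaleR_left inner_sum_right)
    qed
    with d show ?thesis by simp
  qed
qed

text \<open>\<open>filter_kernel\<close> speaks of the reflected translates
  \<open>\<lambda>r'. \<phi> (r - r')\<close>. Undoing the reflection at the single point
  \<open>r0\<close> gives smoothness and compact support of \<phi> itself; with \<open>K\<close> the
  closed support, every \<open>r\<close> in \<open>D\<close> then satisfies the last inclusion for
  this same \<open>K\<close>.\<close>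

lemma filter_kernel_imp_C1:
  assumes "filter_kernel D \<Omega>h \<phi>" and "r0 \<in> D"
  obtains \<phi>' K where "compact K"
    "\<And>y. (\<phi> has_derivative blinfun_apply (\<phi>' y)) (at y)" "continuous_on UNIV \<phi>'"
    "\<And>y. y \<notin> K \<Longrightarrow> \<phi> y = 0" "\<And>y. y \<notin> K \<Longrightarrow> \<phi>' y = 0"
    "\<And>r y. r \<in> D \<Longrightarrow> y \<in> K \<Longrightarrow> r - y \<in> \<Omega>h r"
proof -
  \<comment> \<open>The reflection is split into negation and translation, each of which commutes
    with closure.\<close>
  have *: "closure {x. \<phi> (r - x) \<noteq> 0} = (\<lambda>y. r - y) ` closure {y. \<phi> y \<noteq> 0}" for r
  proof -
    have "{x. \<phi> (r - x) \<noteq> 0} = (+) r ` uminus ` {y. \<phi> y \<noteq> 0}"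
    proof safe
      fix x assume "\<phi> (r - x) \<noteq> 0"
      then show "x \<in> (+) r ` uminus ` {y. \<phi> y \<noteq> 0}"
        by (intro image_eqI[of _ _ "x - r"] image_eqI[of _ _ "r - x"]) auto
    qed auto
    moreover have "closure (uminus ` S) = uminus ` closure S" for S :: "'a set"
      by (intro closure_injective_linear_image[symmetric] linear_uminus) simp
    ultimately show ?thesis
      by (simp only: closure_translation) (simp add: image_image)
  qed
  have Cc: "(\<lambda>x. \<phi> (r - x)) \<in> Cc_infinity (\<Omega>h r)" if "r \<in> D" for r
    using assms that by (simp add: filter_kernel_def)
  have "Ck (Suc 0) (\<lambda>x. \<phi> (r0 - x))"
    using Cc[OF \<open>r0 \<in> D\<close>] unfolding Cc_infinity_def by blast
  then obtain f' where f': "\<And>x. ((\<lambda>x. \<phi> (r0 - x)) has_derivative blinfun_apply (f' x)) (at x)"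
    "continuous_on UNIV f'"
    using Ck_1_has_blinfun_derivative by blast
  \<comment> \<open>The sign is that of the inner derivative in
    \<open>\<phi> y = \<phi> (r0 - (r0 - y))\<close>.\<close>
  define \<phi>' where "\<phi>' y = - f' (r0 - y)" for y
  have d: "(\<phi> has_derivative blinfun_apply (\<phi>' y)) (at y)" for y
  proof -
    have "((\<lambda>y. r0 - y) has_derivative (\<lambda>v. - v)) (at y)"
      by (auto intro!: derivative_eq_intros)
    from has_derivative_compose[OF this f'(1)] show ?thesis
      by (simp add: \<phi>'_def blinfun.minus_right uminus_blinfun.rep_eq)
  qed
  show thesis
  proof
    show "compact (closure {y. \<phi> y \<noteq> 0})"
    proof -
      have "compact (closure {x. \<phi> (r0 - x) \<noteq> 0})"
        using Cc[OF \<open>r0 \<in> D\<close>] by (simp add: Cc_infinity_def)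
      then have "compact ((\<lambda>x. r0 - x) ` closure {x. \<phi> (r0 - x) \<noteq> 0})"
        by (intro compact_continuous_image continuous_intros)
      then show ?thesis by (simp add: * image_image)
    qed
    show "continuous_on UNIV \<phi>'"
      unfolding \<phi>'_def by (intro continuous_intros continuous_on_compose2[OF f'(2)]) auto
    show zero: "\<phi> y = 0" if "y \<notin> closure {y. \<phi> y \<noteq> 0}" for y
      using contra_subsetD[OF closure_subset that] by simp
    show "\<phi>' y = 0" if "y \<notin> closure {y. \<phi> y \<noteq> 0}" for y
    proof -
      have "(\<phi> has_derivative (\<lambda>_. 0)) (at y)"
      proof (rule has_derivative_transform_within_open)
        show "open (- closure {y. \<phi> y \<noteq> 0})" by (rule open_Compl[OF closed_closure])
        show "y \<in> - closure {y. \<phi> y \<noteq> 0}" using that by simp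
        show "0 = \<phi> x" if "x \<in> - closure {y. \<phi> y \<noteq> 0}" for x
          using zero[OF ComplD[OF that]] by (rule sym)
      qed (rule has_derivative_const)
      with d have "blinfun_apply (\<phi>' y) = (\<lambda>_. 0)"
        by (rule has_derivative_unique)
      then show ?thesis by (intro blinfun_eqI) simp
    qed
    show "r - y \<in> \<Omega>h r" if "r \<in> D" "y \<in> closure {y. \<phi> y \<noteq> 0}" for r y
    proof -
      have "closure {x. \<phi> (r - x) \<noteq> 0} \<subseteq> \<Omega>h r"
        using Cc[OF \<open>r \<in> D\<close>] by (simp add: Cc_infinity_def)
      then show ?thesis using that by (auto simp: *)
    qed
  qed (rule d)
qed

section \<open>Testing the filtered continuity equation with the deconvolution filter\<close>

theorem mainTheorem1:
  fixes \<Omega> D :: "'a::euclidean_space set"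
    and T :: "real set"
    and \<Omega>h :: "'a \<Rightarrow> 'a set"
    and w \<phi> :: "'a \<Rightarrow> real"
    and \<rho> p \<rho>h ph :: "real \<Rightarrow> 'a \<Rightarrow> real"
    and u uh :: "real \<Rightarrow> 'a \<Rightarrow> 'a"
    and X :: "real \<Rightarrow> 'a"
  assumes "open \<Omega>" and "open T" and "open D" and "D \<subseteq> \<Omega>"
    and test_spaces: "\<And>r. r \<in> D \<Longrightarrow> test_space \<Omega> r (\<Omega>h r)"
    and continuum_regular:
      "C1_on (T \<times> \<Omega>) (\<lambda>(t, x). \<rho> t x)" "C1_on (T \<times> \<Omega>) (\<lambda>(t, x). u t x)"
      "continuous_on (T \<times> \<Omega>) (\<lambda>(t, x). p t x)"
    and filtered_regular:
      "C1_on (T \<times> \<Omega>) (\<lambda>(t, x). \<rho>h t x)" "C1_on (T \<times> \<Omega>) (\<lambda>(t, x). uh t x)"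
      "continuous_on (T \<times> \<Omega>) (\<lambda>(t, x). ph t x)"
    and convolution_filter: "filter_kernel D \<Omega>h w"
    and FIT: "\<And>t r. t \<in> T \<Longrightarrow> r \<in> D \<Longrightarrow>
      integral_transform \<Omega>h w (\<rho> t) (u t) (p t) (\<rho>h t) (uh t) (ph t) r"
    and deconvolution_filter: "filter_kernel D \<Omega>h \<phi>"
    and DIT: "\<And>t r. t \<in> T \<Longrightarrow> r \<in> D \<Longrightarrow>
      integral_transform \<Omega>h \<phi> (\<rho>h t) (uh t) (ph t) (\<rho> t) (u t) (p t) r"
    and filtered_continuity: "\<And>t x. t \<in> T \<Longrightarrow> x \<in> \<Omega> \<Longrightarrow>
      material_deriv uh \<rho>h t x = - \<rho>h t x * divergence (uh t) x"
    and "t \<in> T" and "r \<in> D"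
    and target_particle: "X t = r" "(X has_vector_derivative u t r) (at t)"
  shows "let RHS = (LINT r':\<Omega>h r|lborel.
               \<rho>h t r' * ((u t r - uh t r') \<bullet> grad (\<lambda>x. \<phi> (x - r')) r))
         in ((\<lambda>s. \<rho> s (X s)) has_real_derivative RHS) (at t) \<and>
            RHS = - \<rho> t r * divergence (u t) r \<and>
            (((\<lambda>s. \<rho> s (X s)) has_real_derivative RHS) (at t) \<longleftrightarrow>
             ((\<lambda>s. \<rho> s (X s)) has_real_derivative - \<rho> t r * divergence (u t) r) (at t))"
proof -
  obtain \<phi>' K where "compact K"
    and \<phi>: "\<And>y. (\<phi> has_derivative blinfun_apply (\<phi>' y)) (at y)" "continuous_on UNIV \<phi>'"
      "\<And>y. y \<notin> K \<Longrightarrow> \<phi> y = 0" "\<And>y. y \<notin> K \<Longrightarrow> \<phi>' y = 0"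
    and sub_h: "\<And>r y. r \<in> D \<Longrightarrow> y \<in> K \<Longrightarrow> r - y \<in> \<Omega>h r"
    using filter_kernel_imp_C1[OF deconvolution_filter \<open>r \<in> D\<close>] by metis
  have sub: "r - y \<in> \<Omega>" if "r \<in> D" "y \<in> K" for r y
    using sub_h[OF that] test_spaces[OF \<open>r \<in> D\<close>] by (auto simp: test_space_def)
  have cont\<phi>: "continuous_on UNIV \<phi>"
    by (rule has_derivative_continuous_on[OF has_derivative_at_withinI[OF \<phi>(1)]])
  \<comment> \<open>Filtered density, velocity and momentum as functions on space-time, so that one
    derivative covers both time and position.\<close>
  define Rh where "Rh = (\<lambda>(t, x). \<rho>h t x)"
  define Vh where "Vh = (\<lambda>(t, x). uh t x)"
  define M where "M z = Rh z *\<^sub>R Vh z" for z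
  obtain Rh' where Rh': "\<And>z. z \<in> T \<times> \<Omega> \<Longrightarrow> (Rh has_derivative blinfun_apply (Rh' z)) (at z)"
    "continuous_on (T \<times> \<Omega>) Rh'"
    using filtered_regular(1) unfolding C1_on_def Rh_def by blast
  obtain Vh' where Vh': "\<And>z. z \<in> T \<times> \<Omega> \<Longrightarrow> (Vh has_derivative blinfun_apply (Vh' z)) (at z)"
    "continuous_on (T \<times> \<Omega>) Vh'"
    using filtered_regular(2) unfolding C1_on_def Vh_def by blast
  define M' where "M' z = Rh z *\<^sub>R Vh' z + (blinfun_scaleR_left (Vh z) o\<^sub>L Rh' z)" for z
  have contR: "continuous_on (T \<times> \<Omega>) Rh" and contV: "continuous_on (T \<times> \<Omega>) Vh"
    by (rule has_derivative_continuous_on[OF has_derivative_at_withinI], erule Rh'(1) Vh'(1))+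
  have M': "(M has_derivative blinfun_apply (M' z)) (at z)" if "z \<in> T \<times> \<Omega>" for z
    unfolding M_def
    by (rule has_derivative_eq_rhs[OF has_derivative_scaleR[OF Rh'(1)[OF that] Vh'(1)[OF that]]])
      (simp add: M'_def fun_eq_iff plus_blinfun.rep_eq scaleR_blinfun.rep_eq)
  have contM': "continuous_on (T \<times> \<Omega>) M'"
    unfolding M'_def by (intro continuous_intros contR contV Rh'(2) Vh'(2))
  have slice: "continuous_on \<Omega> (\<lambda>x. F (t, x))" if "continuous_on (T \<times> \<Omega>) F"
    for F :: "real \<times> 'a \<Rightarrow> 'b::real_normed_vector"
    using \<open>t \<in> T\<close> by (intro continuous_on_compose2[OF that] continuous_intros) auto
  note convolution = \<open>open T\<close> \<open>open \<Omega>\<close> \<open>open D\<close> \<open>compact K\<close>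

  \<comment> \<open>The de-filtering transform over the whole space. The kernel vanishes outside
    \<open>\<Omega>h z\<close>, so the dependence of the test space on \<open>z\<close> contributes
    nothing when the integrals are differentiated.\<close>
  have \<rho>_eq: "\<rho> s z = (LINT x|lborel. \<phi> (z - x) *\<^sub>R Rh (s, x))"
    and momentum_eq: "\<rho> s z *\<^sub>R u s z = (LINT x|lborel. \<phi> (z - x) *\<^sub>R M (s, x))"
    if "s \<in> T" "z \<in> D" for s z
  proof -
    have zero: "\<phi> (z - x) = 0" if "x \<notin> \<Omega>h z" for x
      using \<phi>(3) sub_h[OF \<open>z \<in> D\<close>, of "z - x"] that by auto
    have "(LINT x:\<Omega>h z|lborel. \<rho>h s x * \<phi> (z - x)) = (LINT x|lborel. \<rho>h s x * \<phi> (z - x))"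
      and "(LINT x:\<Omega>h z|lborel. (\<rho>h s x * \<phi> (z - x)) *\<^sub>R uh s x)
        = (LINT x|lborel. (\<rho>h s x * \<phi> (z - x)) *\<^sub>R uh s x)"
      by (rule set_lebesgue_integral_eq_integral_support; simp add: zero)+
    with DIT[OF that]
    have "\<rho> s z = (LINT x|lborel. \<rho>h s x * \<phi> (z - x))"
      and "\<rho> s z *\<^sub>R u s z = (LINT x|lborel. (\<rho>h s x * \<phi> (z - x)) *\<^sub>R uh s x)"
      unfolding integral_transform_def by argo+
    then show "\<rho> s z = (LINT x|lborel. \<phi> (z - x) *\<^sub>R Rh (s, x))"
      and "\<rho> s z *\<^sub>R u s z = (LINT x|lborel. \<phi> (z - x) *\<^sub>R M (s, x))"
      by (simp_all only: M_def Rh_def Vh_def prod.case scaleR_scaleR real_scaleR_def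
          mult.commute[of "\<phi> _"])
  qed

  \<comment> \<open>\<open>P\<close> is the space-time derivative of \<rho> at
    \<open>(t, r)\<close>, with the derivative on the filtered density: \<open>P (1, 0)\<close> is
    the partial time derivative and \<open>P (0, v)\<close> the derivative along
    \<open>v\<close>.\<close>
  define P where "P v = (LINT x|lborel. \<phi> (r - x) *\<^sub>R Rh' (t, x) v)" for v
  have \<rho>_deriv: "((\<lambda>(s, z). \<rho> s z) has_derivative P) (at (t, r))"
  proof (rule has_derivative_transform_within_open)
    show "((\<lambda>z. LINT x|lborel. \<phi> (snd z - x) *\<^sub>R Rh (fst z, x)) has_derivative P) (at (t, r))"
      unfolding P_def
      by (rule has_derivative_convolution_field[OF convolution cont\<phi> \<phi>(3) sub Rh' \<open>t \<in> T\<close> \<open>r \<in> D\<close>])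
    show "open (T \<times> D)" using \<open>open T\<close> \<open>open D\<close> by (rule open_Times)
  qed (use \<open>t \<in> T\<close> \<open>r \<in> D\<close> \<rho>_eq in auto)
  interpret P: bounded_linear P using \<rho>_deriv by (rule has_derivative_bounded_linear)

  have \<rho>_space: "((\<lambda>z. \<rho> t z) has_derivative (\<lambda>v. P (0, v))) (at r)"
  proof -
    have "((\<lambda>z. (t, z)) has_derivative (\<lambda>v. (0, v))) (at r)"
      by (auto intro!: derivative_eq_intros)
    from has_derivative_compose[OF this \<rho>_deriv] show ?thesis by simp
  qed
  \<comment> \<open>The same spatial derivative, now with the derivative on \<phi>; uniqueness of
    derivatives identifies it with \<open>P (0, v)\<close>.\<close>
  have "((\<lambda>z. \<rho> t z) has_derivative (\<lambda>v. LINT x|lborel. \<phi>' (r - x) v *\<^sub>R Rh (t, x))) (at r)"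
    by (rule has_derivative_transform_within_open[OF has_derivative_convolution_kernel
          [OF \<open>open \<Omega>\<close> \<open>open D\<close> \<open>compact K\<close> \<phi> sub slice[OF contR] \<open>r \<in> D\<close>] \<open>open D\<close> \<open>r \<in> D\<close>])
      (use \<rho>_eq \<open>t \<in> T\<close> in auto)
  from has_derivative_unique[OF \<rho>_space this]
  have P_space: "P (0, v) = (LINT x|lborel. \<phi>' (r - x) v *\<^sub>R Rh (t, x))" for v
    by (rule fun_cong)

  \<comment> \<open>\<open>N\<close> is the spatial derivative of the de-filtered momentum at
    \<open>r\<close>, here with the derivative on \<phi>; \<open>N_eq\<close> moves it to the
    filtered momentum.\<close>
  define N where "N v = (LINT x|lborel. \<phi>' (r - x) v *\<^sub>R M (t, x))" for v
  have contM: "continuous_on \<Omega> (\<lambda>x. M (t, x))"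
    unfolding M_def by (intro continuous_intros slice contR contV)
  have N: "((\<lambda>z. LINT x|lborel. \<phi> (z - x) *\<^sub>R M (t, x)) has_derivative N) (at r)"
    unfolding N_def
    by (rule has_derivative_convolution_kernel
        [OF \<open>open \<Omega>\<close> \<open>open D\<close> \<open>compact K\<close> \<phi> sub contM \<open>r \<in> D\<close>])
  have N_eq: "N v = (LINT x|lborel. \<phi> (r - x) *\<^sub>R M' (t, x) (0, v))" for v
  proof -
    have "((\<lambda>z. (t, z)) has_derivative (\<lambda>v. (0, v))) (at r)"
      by (auto intro!: derivative_eq_intros)
    from has_derivative_compose[OF this has_derivative_convolution_field
        [OF convolution cont\<phi> \<phi>(3) sub M' contM' \<open>t \<in> T\<close> \<open>r \<in> D\<close>]]
    show ?thesis using has_derivative_unique[OF N] by (simp add: fun_eq_iff)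
  qed

  have int_field: "integrable lborel (\<lambda>x. \<phi> (r - x) *\<^sub>R F x)" if "continuous_on \<Omega> F"
    for F :: "'a \<Rightarrow> 'b::euclidean_space"
    using integrable_convolution_integrand[OF \<open>open \<Omega>\<close> \<open>compact K\<close> cont\<phi> \<phi>(3) sub that]
      \<open>r \<in> D\<close> by blast
  have int_kernel: "integrable lborel (\<lambda>x. \<phi>' (r - x) v *\<^sub>R F x)" if "continuous_on \<Omega> F"
    for F :: "'a \<Rightarrow> 'b::euclidean_space" and v
  proof (rule integrable_convolution_integrand[OF \<open>open \<Omega>\<close> \<open>compact K\<close> _ _ _ that])
    show "continuous_on UNIV (\<lambda>y. \<phi>' y v)" by (intro continuous_intros \<phi>(2))
  qed (use \<phi>(4) sub \<open>r \<in> D\<close> in auto)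

  \<comment> \<open>The filtered continuity equation in conservation form: the product rule merges
    the advection term and the divergence term into the divergence of the filtered momentum.\<close>
  have time_derivative: "Rh' (t, x) (1, 0) = - (\<Sum>b\<in>Basis. M' (t, x) (0, b) \<bullet> b)" if "x \<in> \<Omega>" for x
  proof -
    have tx: "(t, x) \<in> T \<times> \<Omega>" using \<open>t \<in> T\<close> that by simp
    have "((\<lambda>s. (s, x)) has_derivative (\<lambda>h. (h, 0))) (at t)"
      and slice_x: "((\<lambda>z. (t, z)) has_derivative (\<lambda>v. (0, v))) (at x)"
      by (auto intro!: derivative_eq_intros)
    from has_derivative_compose[OF this(1) Rh'(1)[OF tx]]
    have "((\<lambda>s. \<rho>h s x) has_derivative (\<lambda>h. Rh' (t, x) (h, 0))) (at t)"
      by (simp add: Rh_def)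
    moreover have "(\<lambda>h. Rh' (t, x) (h, 0)) = (*) (Rh' (t, x) (1, 0))"
    proof
      show "Rh' (t, x) (h, 0) = Rh' (t, x) (1, 0) * h" for h
        using blinfun.scaleR_right[of "Rh' (t, x)" h "(1, 0)"] by simp
    qed
    ultimately have dt: "deriv (\<lambda>s. \<rho>h s x) t = Rh' (t, x) (1, 0)"
      by (intro DERIV_imp_deriv) (simp only: has_field_derivative_def)
    have dx: "((\<lambda>z. \<rho>h t z) has_derivative (\<lambda>v. Rh' (t, x) (0, v))) (at x)"
      using has_derivative_compose[OF slice_x Rh'(1)[OF tx]] by (simp add: Rh_def)
    have "((\<lambda>z. uh t z) has_derivative (\<lambda>v. Vh' (t, x) (0, v))) (at x)"
      using has_derivative_compose[OF slice_x Vh'(1)[OF tx]] by (simp add: Vh_def)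
    from divergence_eq[OF this] filtered_continuity[OF \<open>t \<in> T\<close> that] dt grad_eq[OF dx, of "uh t x"]
    have "Rh' (t, x) (1, 0) =
        - Rh' (t, x) (0, uh t x) - \<rho>h t x * (\<Sum>b\<in>Basis. Vh' (t, x) (0, b) \<bullet> b)"
      by (simp add: material_deriv_def)
    with linear_functional_eq_sum_Basis[OF has_derivative_linear[OF dx], of "uh t x"]
    show ?thesis
      by (simp add: M'_def Rh_def Vh_def blinfun.add_left blinfun.scaleR_left inner_add_left
          sum.distrib sum_distrib_left mult.commute)
  qed

  \<comment> \<open>The testing step: the conservation form is multiplied by \<phi> and integrated.
    It holds on \<Omega>, which is enough since the kernel vanishes elsewhere.\<close>
  have P_time: "P (1, 0) = - (\<Sum>b\<in>Basis. N b \<bullet> b)"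
  proof -
    have int: "integrable lborel (\<lambda>x. \<phi> (r - x) *\<^sub>R M' (t, x) (0, b))" for b
      by (intro int_field continuous_intros slice contM')
    have "(\<Sum>b\<in>Basis. N b \<bullet> b)
        = (\<Sum>b\<in>Basis. LINT x|lborel. (\<phi> (r - x) *\<^sub>R M' (t, x) (0, b)) \<bullet> b)"
      by (simp only: N_eq integral_inner_left[OF int])
    also have "\<dots> = (LINT x|lborel. (\<Sum>b\<in>Basis. (\<phi> (r - x) *\<^sub>R M' (t, x) (0, b)) \<bullet> b))"
      by (intro Bochner_Integration.integral_sum[symmetric] integrable_inner_left int)
    also have "\<dots> = (LINT x|lborel. - (\<phi> (r - x) *\<^sub>R Rh' (t, x) (1, 0)))"
    proof (rule Bochner_Integration.integral_cong)
      show "(\<Sum>b\<in>Basis. (\<phi> (r - x) *\<^sub>R M' (t, x) (0, b)) \<bullet> b) = - (\<phi> (r - x) *\<^sub>R Rh' (t, x) (1, 0))"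
        for x
      proof (cases "r - x \<in> K")
        case True
        then have "x \<in> \<Omega>" using sub[OF \<open>r \<in> D\<close>, of "r - x"] by simp
        then show ?thesis by (simp add: time_derivative sum_distrib_left)
      qed (simp add: \<phi>(3))
    qed simp
    finally show ?thesis by (simp add: P_def)
  qed

  \<comment> \<open>On \<open>D\<close> the de-filtered momentum is the product of \<rho> and
    \<open>u\<close>, so the product rule splits its divergence; differentiability of
    \<open>u\<close> comes from the regularity of the continuum velocity.\<close>
  have divergence_momentum: "(\<Sum>b\<in>Basis. N b \<bullet> b) = \<rho> t r * divergence (u t) r + P (0, u t r)"
  proof -
    obtain U' where "((\<lambda>(t, x). u t x) has_derivative blinfun_apply U') (at (t, r))"
      using continuum_regular(2) \<open>t \<in> T\<close> \<open>r \<in> D\<close> \<open>D \<subseteq> \<Omega>\<close> unfolding C1_on_def by blast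
    moreover have "((\<lambda>z. (t, z)) has_derivative (\<lambda>v. (0, v))) (at r)"
      by (auto intro!: derivative_eq_intros)
    ultimately have u: "((\<lambda>z. u t z) has_derivative (\<lambda>v. U' (0, v))) (at r)"
      using has_derivative_compose by fastforce
    have "((\<lambda>z. \<rho> t z *\<^sub>R u t z) has_derivative N) (at r)"
      by (rule has_derivative_transform_within_open[OF N \<open>open D\<close> \<open>r \<in> D\<close>])
        (use momentum_eq \<open>t \<in> T\<close> in auto)
    from has_derivative_unique[OF this has_derivative_scaleR[OF \<rho>_space u]]
    have "(\<Sum>b\<in>Basis. N b \<bullet> b)
        = \<rho> t r * (\<Sum>b\<in>Basis. U' (0, b) \<bullet> b) + (\<Sum>b\<in>Basis. (u t r \<bullet> b) * P (0, b))"
      by (simp add: inner_add_left sum.distrib sum_distrib_left mult.commute)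
    then show ?thesis
      using linear_functional_eq_sum_Basis[OF has_derivative_linear[OF \<rho>_space], of "u t r"]
        divergence_eq[OF u] by simp
  qed

  define RHS where "RHS = (LINT r':\<Omega>h r|lborel.
    \<rho>h t r' * ((u t r - uh t r') \<bullet> grad (\<lambda>x. \<phi> (x - r')) r))"
  \<comment> \<open>The velocity \<open>u t r\<close> is constant in the integration variable, so
    its term is the derivative of \<rho> along it. The term with \<open>uh\<close> carries the
    filtered momentum and sums to the divergence of the de-filtered momentum.\<close>
  have RHS: "RHS = P (0, u t r) - (\<Sum>b\<in>Basis. N b \<bullet> b)"
  proof -
    have grad: "v \<bullet> grad (\<lambda>x. \<phi> (x - x')) r = \<phi>' (r - x') v" for v x'
    proof -
      have "((\<lambda>x. x - x') has_derivative (\<lambda>v. v)) (at r)"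
        by (auto intro!: derivative_eq_intros)
      from grad_eq[OF has_derivative_compose[OF this \<phi>(1)]] show ?thesis .
    qed
    have int: "integrable lborel (\<lambda>x. \<phi>' (r - x) v *\<^sub>R M (t, x))" for v
      by (intro int_kernel contM)
    have "\<phi>' (r - x) = 0" if "x \<notin> \<Omega>h r" for x
      using \<phi>(4) sub_h[OF \<open>r \<in> D\<close>, of "r - x"] that by auto
    then have "RHS = (LINT x|lborel. \<rho>h t x * \<phi>' (r - x) (u t r - uh t x))"
      unfolding RHS_def grad by (intro set_lebesgue_integral_eq_integral_support) simp
    also have "\<dots> = (LINT x|lborel. \<phi>' (r - x) (u t r) *\<^sub>R Rh (t, x)
        - (\<Sum>b\<in>Basis. (\<phi>' (r - x) b *\<^sub>R M (t, x)) \<bullet> b))"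
    proof (rule Bochner_Integration.integral_cong)
      fix x
      have "(\<Sum>b\<in>Basis. (\<phi>' (r - x) b *\<^sub>R M (t, x)) \<bullet> b) = \<phi>' (r - x) (M (t, x))"
        using linear_functional_eq_sum_Basis[OF has_derivative_linear[OF \<phi>(1)], of "r - x" "M (t, x)"]
        by (simp add: mult.commute)
      then show "\<rho>h t x * \<phi>' (r - x) (u t r - uh t x) = \<phi>' (r - x) (u t r) *\<^sub>R Rh (t, x)
          - (\<Sum>b\<in>Basis. (\<phi>' (r - x) b *\<^sub>R M (t, x)) \<bullet> b)"
        by (simp add: M_def Rh_def Vh_def blinfun.diff_right blinfun.scaleR_right algebra_simps)
    qed simp
    also have "\<dots> = P (0, u t r) - (LINT x|lborel. (\<Sum>b\<in>Basis. (\<phi>' (r - x) b *\<^sub>R M (t, x)) \<bullet> b))"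
      unfolding P_space
      by (intro Bochner_Integration.integral_diff Bochner_Integration.integrable_sum
          integrable_inner_left int int_kernel slice contR)
    also have "(LINT x|lborel. (\<Sum>b\<in>Basis. (\<phi>' (r - x) b *\<^sub>R M (t, x)) \<bullet> b))
        = (\<Sum>b\<in>Basis. LINT x|lborel. (\<phi>' (r - x) b *\<^sub>R M (t, x)) \<bullet> b)"
      by (intro Bochner_Integration.integral_sum integrable_inner_left int)
    also have "\<dots> = (\<Sum>b\<in>Basis. N b \<bullet> b)"
      by (simp only: N_def integral_inner_left[OF int])
    finally show ?thesis .
  qed

  have "((\<lambda>s. \<rho> s (X s)) has_derivative (\<lambda>h. P (h, h *\<^sub>R u t r))) (at t)"
  proof -
    have "((\<lambda>s. (s, X s)) has_derivative (\<lambda>h. (h, h *\<^sub>R u t r))) (at t)"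
      using target_particle(2) unfolding has_vector_derivative_def
      by (intro has_derivative_Pair has_derivative_ident)
    moreover have "((\<lambda>(s, z). \<rho> s z) has_derivative P) (at (t, X t))"
      using \<rho>_deriv target_particle(1) by simp
    ultimately show ?thesis using has_derivative_compose by fastforce
  qed
  \<comment> \<open>By linearity the derivative along the particle is the time derivative plus the
    derivative along \<open>u t r\<close>. \<open>P_time\<close> replaces the former by minus the
    divergence of the momentum, which gives the expression found for \<open>RHS\<close>.\<close>
  moreover have "P (h, h *\<^sub>R u t r) = RHS * h" for h
  proof -
    have "P (h, h *\<^sub>R u t r) = P (h *\<^sub>R ((1, 0) + (0, u t r)))" by simp
    also have "\<dots> = h * (P (1, 0) + P (0, u t r))" by (simp only: P.scaleR P.add real_scaleR_def)
    finally show ?thesis using P_time RHS by simp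
  qed
  ultimately have "((\<lambda>s. \<rho> s (X s)) has_real_derivative RHS) (at t)"
    by (simp add: has_field_derivative_def)
  \<comment> \<open>The advection term \<open>P (0, u t r)\<close> cancels between
    \<open>RHS\<close> and \<open>divergence_momentum\<close>. Both candidate values of the
    derivative then coincide, whence the equivalence.\<close>
  moreover have "RHS = - \<rho> t r * divergence (u t) r"
    using RHS divergence_momentum by simp
  ultimately show ?thesis
    unfolding RHS_def[symmetric] Let_def by simp
qed

end
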